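(* Let $D_{\mathrm{I}}$ and $D_{\mathrm{II}}$ be finite nonempty sets (the training data with label I and with label II). Consider a fractal ensemble classifier with $K$ subtask classifiers built on a type-I fractal structure with $L\ge 1$ levels on $(D_{\mathrm{I}},D_{\mathrm{II}})$ (so that every first-level subtask is trained on all data with label II), with a uniform parameter $b_1=\dots=b_K=b$, where $0\le b\le 1$, and with scale parameters $s_1,\dots,s_K>0$. Let $\mathbf{t}$ be an input whose true label is I, and let $x_j=\mathrm{sigmoid}(s_j\cdot G_j(\mathbf{t}))$ for $1\le j\le K$. Suppose there exists a first-level subtask $i$ such that $x_i>0.5$ and $x_j\ge 1-x_i$ for every subtask $j\ne i$ (in any level). Then the ensemble classifies $\mathbf{t}$ correctly, i.e. its final outputs on $\mathbf{t}$ satisfy $w_{\mathrm{I}}>w_{\mathrm{II}}$.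
   Context: Fractal structures. Let $P\subseteq D_{\mathrm{I}}$ and $Q\subseteq D_{\mathrm{II}}$ be nonempty. A subtask is a pair $(A,B)$ of nonempty sets $A\subseteq D_{\mathrm{I}}$, $B\subseteq D_{\mathrm{II}}$ (its training subset). Type-I and type-II fractal structures with $L$ levels on $(P,Q)$ are defined recursively. - Type I, $L=1$: a partition of $P$ into nonempty sets $P_1,\dots,P_m$ ($m\ge1$). The subtasks are $(P_k,Q)$, $1\le k\le m$, all of which are first-level. - Type I, $L\ge2$: pairwise disjoint nonempty sets $P_1,\dots,P_m\subseteq P$ ($m\ge 1$) whose union is a proper subset of $P$, together with a type-II fractal structure with $L-1$ levels on $(P',Q)$, where $P'=P\setminus\bigcup_k P_k$. The first-level subtasks are $(P_k,Q)$, $1\le k\le m$. The level-$\ell$ subtasks of the type-II structure become the level-$(\ell+1)$ subtasks. - Type II: the same with the roles of the two labels exchanged. That is, $Q$ is split into disjoint nonempty sets $Q_1,\dots,Q_m$ (covering $Q$ if $L=1$, with union a proper subset of $Q$ if $L\ge2$), the first-level subtasks are $(P,Q_k)$, and if $L\ge2$ the structure continues with a type-I structure with $L-1$ levels on $(P,Q\setminus\bigcup_kQ_k)$. Thus the products $A\times B$ over all subtasks of a structure on $(D_{\mathrm{I}},D_{\mathrm{II}})$ partition $D_{\mathrm{I}}\times D_{\mathrm{II}}$. Index all subtasks by $1,\dots,K$ and write subtask $j$ as $(A_j,B_j)$. Subtask classifiers. Subtask $j$ has a real-valued function $G_j$ of the input that is 1-Lipschitz with respect to the $L_2$ metric (a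 scalar-output $L_2$-nonexpansive neural network), a scalar $s_j>0$ and a scalar $b_j$ with $0\le b_j\le 1$. Put $f_{\mathrm{I},j}=|A_j|/|D_{\mathrm{I}}|$, $f_{\mathrm{II},j}=|B_j|/|D_{\mathrm{II}}|$, and $x_j=\mathrm{sigmoid}(s_jG_j(\mathbf{t}))$, where $\mathrm{sigmoid}(z)=1/(1+e^{-z})$. The belief against label I is $$b_{\mathrm{I},j}=\frac{2 b_j f_{\mathrm{I},j}(0.5-x_j)}{1-0.5b_j+b_jf_{\mathrm{I},j}(0.5-x_j)}\ \text{ if } x_j<0.5,\qquad b_{\mathrm{I},j}=0\ \text{ otherwise},$$ and the belief against label II is $$b_{\mathrm{II},j}=\frac{2 b_j f_{\mathrm{II},j}(x_j-0.5)}{1-0.5b_j+b_jf_{\mathrm{II},j}(x_j-0.5)}\ \text{ if } x_j>0.5,\qquad b_{\mathrm{II},j}=0\ \text{ otherwise}.$$ Set $w_{\mathrm{I},j}=\log(1-b_{\mathrm{I},j})$ and $w_{\mathrm{II},j}=\log(1-b_{\mathrm{II},j})$ (negatives of the weights of evidence against labels I and II). Fractal aggregation. The outputs $(w_{\mathrm{I}},w_{\mathrm{II}})$ of a fractal structure are defined recursively. For a type-I structure with first-level subtasks indexed by the set $M$ and, if $L\ge2$, remaining type-II structure with outputs $(w'_{\mathrm{I}},w'_{\mathrm{II}})$, $$w_{\mathrm{I}}=\sum_{k\in M}w_{\mathrm{I},k}+w'_{\mathrm{I}},\qquad w_{\mathrm{II}}=\min\Bigl(\min_{k\in M}w_{\mathrm{II},k},\,w'_{\mathrm{II}}\Bigr),$$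 where the primed terms are omitted if $L=1$. For a type-II structure with first-level subtasks indexed by the set $M$ and, if $L\ge2$, remaining type-I structure with outputs $(w'_{\mathrm{I}},w'_{\mathrm{II}})$, $$w_{\mathrm{I}}=\min\Bigl(\min_{k\in M}w_{\mathrm{I},k},\,w'_{\mathrm{I}}\Bigr),\qquad w_{\mathrm{II}}=\sum_{k\in M}w_{\mathrm{II},k}+w'_{\mathrm{II}},$$ again with the primed terms omitted if $L=1$. The final outputs of the ensemble on $\mathbf{t}$ are those of the whole structure on $(D_{\mathrm{I}},D_{\mathrm{II}})$. The ensemble predicts the label with the least evidence against it, i.e. the label with the larger $w$ value.
   Formalization: The uniform parameter b is assumed to satisfy 0 < b ≤ 1 instead of 0 ≤ b ≤ 1; for b = 0 all beliefs and weights vanish, so w_I = w_II = 0 and the strict inequality w_I > w_II always fails. *)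

theory Defs
  imports "HOL-Analysis.Analysis"
begin

text \<open>
  A fractal structure is given by the list \<open>Ms\<close> of the index sets of its levels (first level
  first), where subtask \<open>j\<close> is \<open>(A j, B j)\<close>. The number of levels is \<open>length Ms\<close>.
  No index can occur in two levels: \<open>A j\<close> and \<open>B j\<close> are nonempty, and the products
  \<open>A j \<times> B j\<close> of different levels are disjoint.
\<close>

fun type_I_structure :: "(nat \<Rightarrow> 'a set) \<Rightarrow> (nat \<Rightarrow> 'b set) \<Rightarrow> 'a set \<Rightarrow> 'b set \<Rightarrow> nat set list \<Rightarrow> bool"
  and type_II_structure :: "(nat \<Rightarrow> 'a set) \<Rightarrow> (nat \<Rightarrow> 'b set) \<Rightarrow> 'a set \<Rightarrow> 'b set \<Rightarrow> nat set list \<Rightarrow> bool"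
where
  "type_I_structure A B P Q [] \<longleftrightarrow> False"
| "type_I_structure A B P Q (M # Ms) \<longleftrightarrow>
     finite M \<and> M \<noteq> {} \<and> disjoint_family_on A M \<and> (\<forall>k\<in>M. A k \<noteq> {} \<and> B k = Q) \<and>
     (if Ms = [] then (\<Union>k\<in>M. A k) = P
      else (\<Union>k\<in>M. A k) \<subset> P \<and> type_II_structure A B (P - (\<Union>k\<in>M. A k)) Q Ms)"
| "type_II_structure A B P Q [] \<longleftrightarrow> False"
| "type_II_structure A B P Q (M # Ms) \<longleftrightarrow>
     finite M \<and> M \<noteq> {} \<and> disjoint_family_on B M \<and> (\<forall>k\<in>M. B k \<noteq> {} \<and> A k = P) \<and>
     (if Ms = [] then (\<Union>k\<in>M. B k) = Q
      else (\<Union>k\<in>M. B k) \<subset> Q \<and> type_I_structure A B P (Q - (\<Union>k\<in>M. B k)) Ms)"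

definition sigmoid :: "real \<Rightarrow> real" where
  "sigmoid z = 1 / (1 + exp (- z))"

definition belief_I :: "real \<Rightarrow> real \<Rightarrow> real \<Rightarrow> real" where
  "belief_I b f x =
     (if x < 0.5 then 2 * b * f * (0.5 - x) / (1 - 0.5 * b + b * f * (0.5 - x)) else 0)"

definition belief_II :: "real \<Rightarrow> real \<Rightarrow> real \<Rightarrow> real" where
  "belief_II b f x =
     (if x > 0.5 then 2 * b * f * (x - 0.5) / (1 - 0.5 * b + b * f * (x - 0.5)) else 0)"

definition weight_I :: "'a set \<Rightarrow> (nat \<Rightarrow> 'a set) \<Rightarrow> (nat \<Rightarrow> real) \<Rightarrow> (nat \<Rightarrow> real) \<Rightarrow> nat \<Rightarrow> real" where
  "weight_I D\<^sub>I A b x j = ln (1 - belief_I (b j) (real (card (A j)) / real (card D\<^sub>I)) (x j))"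

definition weight_II :: "'b set \<Rightarrow> (nat \<Rightarrow> 'b set) \<Rightarrow> (nat \<Rightarrow> real) \<Rightarrow> (nat \<Rightarrow> real) \<Rightarrow> nat \<Rightarrow> real" where
  "weight_II D\<^sub>I\<^sub>I B b x j = ln (1 - belief_II (b j) (real (card (B j)) / real (card D\<^sub>I\<^sub>I)) (x j))"

text \<open>
  The pair \<open>(w\<^sub>I, w\<^sub>I\<^sub>I)\<close> of outputs of a structure with weights \<open>u\<close> (label I) and \<open>v\<close> (label II).
  The value at the empty list is a dummy, since a structure has at least one level.
\<close>

fun type_I_outputs :: "(nat \<Rightarrow> real) \<Rightarrow> (nat \<Rightarrow> real) \<Rightarrow> nat set list \<Rightarrow> real \<times> real"
  and type_II_outputs :: "(nat \<Rightarrow> real) \<Rightarrow> (nat \<Rightarrow> real) \<Rightarrow> nat set list \<Rightarrow> real \<times> real"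
where
  "type_I_outputs u v [] = (0, 0)"
| "type_I_outputs u v (M # Ms) =
     (if Ms = [] then (\<Sum>k\<in>M. u k, Min (v ` M))
      else let (u', v') = type_II_outputs u v Ms
           in ((\<Sum>k\<in>M. u k) + u', min (Min (v ` M)) v'))"
| "type_II_outputs u v [] = (0, 0)"
| "type_II_outputs u v (M # Ms) =
     (if Ms = [] then (Min (u ` M), \<Sum>k\<in>M. v k)
      else let (u', v') = type_I_outputs u v Ms
           in (min (Min (u ` M)) u', (\<Sum>k\<in>M. v k) + v'))"

lemma outputs_of_zero_weights:
  shows "type_I_structure A B P Q Ms \<Longrightarrow> (\<And>j. u j = 0) \<Longrightarrow> (\<And>j. v j = 0)
           \<Longrightarrow> type_I_outputs u v Ms = (0, 0)"
    and "type_II_structure A B P Q Ms \<Longrightarrow> (\<And>j. u j = 0) \<Longrightarrow> (\<And>j. v j = 0)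
           \<Longrightarrow> type_II_outputs u v Ms = (0, 0)"
  by (induction A B P Q Ms and A B P Q Ms rule: type_I_structure_type_II_structure.induct)
     (auto simp: image_constant_conv split: if_splits)

text \<open>
  With belief parameter 0 the two outputs always tie, so no strict inequality between them can
  hold without a positive parameter.
\<close>

lemma outputs_of_zero_belief:
  assumes "type_I_structure A B P Q Ms"
  shows "type_I_outputs (weight_I D\<^sub>I A (\<lambda>_. 0) x) (weight_II D\<^sub>I\<^sub>I B (\<lambda>_. 0) x) Ms = (0, 0)"
  by (rule outputs_of_zero_weights(1)[OF assms])
     (simp_all add: weight_I_def weight_II_def belief_I_def belief_II_def)

end

theory Submission
  imports Defs
begin

text \<open>
  Each weight is \<open>- 2 artanh z\<close> with \<open>z\<close> proportional to the training fraction, and \<open>artanh\<close> is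
  convex with \<open>artanh 0 = 0\<close>. Hence if every subtask satisfies \<open>x\<^sub>j \<ge> 1 - x\<^sub>i\<close>, the weight
  against label I of subtask \<open>j\<close> is at least the fraction \<open>f\<^sub>I\<^sub>,\<^sub>j\<close> of the weight \<open>w\<close> against
  label II of subtask \<open>i\<close>, for which \<open>f\<^sub>I\<^sub>I\<^sub>,\<^sub>i = 1\<close>. Such fractional bounds propagate through
  the aggregation and give \<open>w\<^sub>I \<ge> w \<ge> w\<^sub>I\<^sub>I\<close>. The first inequality is strict because subtask \<open>i\<close>
  itself contributes nothing against label I.
\<close>

text \<open>The derivative \<open>1 / (1 - x\<^sup>2)\<close> increases only for nonnegative
  arguments, so the interval starts at 0.\<close>

lemma convex_on_artanh: "convex_on {0..<1} (artanh :: real \<Rightarrow> real)"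
proof (rule convex_on_realI)
  fix x y :: real
  assume "x \<in> {0..<1}" "y \<in> {0..<1}" "x \<le> y"
  then have "x\<^sup>2 \<le> y\<^sup>2" "y\<^sup>2 < 1"
    by (auto simp: power_mono power_less_one_iff abs_square_less_1)
  then show "1 / (1 - x\<^sup>2) \<le> 1 / (1 - y\<^sup>2)"
    by (intro divide_left_mono) auto
qed (auto intro!: artanh_real_has_field_derivative)

text \<open>Convexity along the chord from 0 to \<open>z\<close>; the term at the endpoint 0
  vanishes.\<close>

lemma artanh_mult_le:
  fixes f z :: real
  assumes "0 \<le> f" "f \<le> 1" "0 \<le> z" "z < 1"
  shows "artanh (f * z) \<le> f * artanh z"
  using convex_onD[OF convex_on_artanh, of f 0 z] assms by (simp add: artanh_def)

lemma artanh_real_mono: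
  fixes y z :: real
  assumes "- 1 < y" "y \<le> z" "z < 1"
  shows "artanh y \<le> artanh z"
proof -
  have "(1 + y) / (1 - y) \<le> (1 + z) / (1 - z)"
    using assms by (intro frac_le) auto
  then show ?thesis
    using assms by (simp add: artanh_def)
qed

text \<open>On its first branch each belief has the shape \<open>2 * y / (c + y)\<close> with
  \<open>c = 1 - b / 2\<close>. Its complement \<open>(c - y) / (c + y)\<close> is the reciprocal of
  the quotient inside the logarithm of \<open>artanh (y / c)\<close>.\<close>

lemma ln_weight_eq_artanh:
  fixes c y :: real
  assumes "\<bar>y\<bar> < c"
  shows "ln (1 - 2 * y / (c + y)) = - 2 * artanh (y / c)"
proof -
  have nz: "c \<noteq> 0" "c + y \<noteq> 0" "c - y \<noteq> 0"
    using assms by auto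
  have "1 - 2 * y / (c + y) = inverse ((1 + y / c) / (1 - y / c))"
    using nz by (simp add: divide_simps)
  moreover have "\<bar>y / c\<bar> < 1"
    using assms by (simp add: abs_less_iff)
  then have "(1 + y / c) / (1 - y / c) > 0"
    by (intro divide_pos_pos) linarith+
  ultimately show ?thesis
    by (simp add: artanh_def ln_inverse del: inverse_divide)
qed

text \<open>Keeps the arguments of \<open>artanh\<close> below 1: \<open>b * d < b / 2\<close>, and
  \<open>b / 2 \<le> 1 - b / 2\<close> because \<open>b \<le> 1\<close>.\<close>

lemma belief_margin_less:
  fixes b d :: real
  assumes "0 < b" "b \<le> 1" "d < 1/2"
  shows "b * d < 1 - b / 2"
  using mult_strict_left_mono[of d "1/2" b] assms by linarith

lemma ln_belief_II_full:
  assumes "0 < b" "b \<le> 1" "1/2 < x" "x < 1"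
  shows "ln (1 - belief_II b 1 x) = - 2 * artanh (b * (x - 1/2) / (1 - b / 2))"
proof -
  have "0 < b * (x - 1/2)" "b * (x - 1/2) < 1 - b / 2"
    using belief_margin_less[of b "x - 1/2"] assms by auto
  then show ?thesis
    using ln_weight_eq_artanh[of "b * (x - 1/2)" "1 - b / 2"] assms(3)
    by (simp add: belief_II_def mult.assoc)
qed

text \<open>The comparison of a single subtask with subtask \<open>i\<close>. For
  \<open>y < 1/2\<close> convexity pulls the factor \<open>f\<close> out of \<open>artanh\<close>;
  otherwise the right side is 0 and the left side is nonpositive.\<close>

lemma ln_belief_I_ge:
  assumes "0 < b" "b \<le> 1" "0 \<le> f" "f \<le> 1" "1/2 < x" "x < 1" "1 - x \<le> y"
  shows "f * ln (1 - belief_II b 1 x) \<le> ln (1 - belief_I b f y)"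
proof -
  let ?c = "1 - b / 2"
  let ?z = "b * (x - 1/2) / ?c"
  have c: "b * (x - 1/2) < ?c" "0 < ?c"
    using belief_margin_less[of b "x - 1/2"] assms by auto
  have z: "0 < ?z" "?z < 1"
    using c assms by auto
  have full: "ln (1 - belief_II b 1 x) = - 2 * artanh ?z"
    using assms by (intro ln_belief_II_full) auto
  show ?thesis
  proof (cases "y < 1/2")
    case True
    let ?y = "b * f * (1/2 - y)"
    \<comment> \<open>The hypothesis \<open>1 - x \<le> y\<close> says that the margin
      \<open>1/2 - y\<close> is at most \<open>x - 1/2\<close>.\<close>
    have le: "?y \<le> f * (b * (x - 1/2))"
      using mult_left_mono[of "1/2 - y" "x - 1/2" "b * f"] assms by (simp add: mult.left_commute mult.assoc)
    have "f * (b * (x - 1/2)) \<le> b * (x - 1/2)"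
      using assms by (intro mult_left_le_one_le) auto
    then have "?y < ?c"
      using le c by linarith
    moreover have "0 \<le> ?y"
      using True assms by simp
    ultimately have y: "0 \<le> ?y" "?y < ?c"
      by simp_all
    have "?y / ?c \<le> f * ?z"
      using divide_right_mono[OF le, of ?c] c by simp
    moreover have "f * ?z < 1"
      using mult_left_le_one_le[of ?z f] z assms by linarith
    moreover have "0 \<le> ?y / ?c"
      using y c by simp
    ultimately have "artanh (?y / ?c) \<le> artanh (f * ?z)"
      by (intro artanh_real_mono) linarith+
    also have "\<dots> \<le> f * artanh ?z"
      using z assms by (intro artanh_mult_le) auto
    finally have "f * ln (1 - belief_II b 1 x) \<le> - 2 * artanh (?y / ?c)"
      unfolding full by simp
    also have "\<dots> = ln (1 - 2 * ?y / (?c + ?y))"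
      using y by (intro ln_weight_eq_artanh[symmetric]) auto
    also have "\<dots> = ln (1 - belief_I b f y)"
      using True by (simp add: belief_I_def mult.assoc)
    finally show ?thesis .
  next
    case False
    have "0 \<le> artanh ?z"
      using artanh_real_mono[of 0 ?z] z by (simp add: artanh_def)
    then show ?thesis
      using False assms unfolding full by (simp add: belief_I_def)
  qed
qed

lemma card_type_I_structure_Cons:
  assumes "type_I_structure A B P Q (M # Ms)" "finite P"
  shows "card P = (\<Sum>k\<in>M. card (A k)) + card (P - (\<Union>k\<in>M. A k))"
proof -
  let ?U = "\<Union>k\<in>M. A k"
  have M: "finite M" "disjoint_family_on A M" and sub: "?U \<subseteq> P"
    using assms(1) by (auto split: if_splits)
  have "finite (A k)" if "k \<in> M" for k
    using sub \<open>finite P\<close> that by (meson UN_subset_iff finite_subset)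
  then have "card ?U = (\<Sum>k\<in>M. card (A k))"
    using M by (intro card_UN_disjoint) (auto simp: disjoint_family_on_def)
  moreover have "card P = card ?U + card (P - ?U)"
    using card_Diff_subset[of ?U P] card_mono[of P ?U] sub \<open>finite P\<close> by (simp add: finite_subset)
  ultimately show ?thesis
    by simp
qed

text \<open>A missing remaining structure counts as 0, which matches the empty remainder of
  \<open>P\<close> at the last level.\<close>

lemma fst_type_I_outputs_Cons:
  "fst (type_I_outputs u v (M # Ms)) =
     sum u M + (if Ms = [] then 0 else fst (type_II_outputs u v Ms))"
  by (simp add: split_beta)

text \<open>Here \<open>c\<close> is a weight per training example of label I. At a type-I level the
  bounds add up over disjoint pieces of \<open>P\<close>; at a type-II level \<open>P\<close> is
  unchanged and a minimum preserves the common bound.\<close>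

lemma fst_outputs_ge:
  fixes c :: real
  shows "type_I_structure A B P Q Ms \<Longrightarrow> finite P
      \<Longrightarrow> (\<And>j. j \<in> \<Union> (set Ms) \<Longrightarrow> c * card (A j) \<le> u j)
      \<Longrightarrow> c * card P \<le> fst (type_I_outputs u v Ms)"
    and "type_II_structure A B P Q Ms \<Longrightarrow> finite P
      \<Longrightarrow> (\<And>j. j \<in> \<Union> (set Ms) \<Longrightarrow> c * card (A j) \<le> u j)
      \<Longrightarrow> c * card P \<le> fst (type_II_outputs u v Ms)"
proof (induction A B P Q Ms and A B P Q Ms rule: type_I_structure_type_II_structure.induct)
  case (2 A B P Q M Ms)
  let ?U = "\<Union>k\<in>M. A k"
  have "c * card P = (\<Sum>k\<in>M. c * card (A k)) + c * card (P - ?U)"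
    using card_type_I_structure_Cons[OF "2.prems"(1,2)] by (simp add: sum_distrib_left distrib_left)
  moreover have "(\<Sum>k\<in>M. c * card (A k)) \<le> sum u M"
    using "2.prems"(3) by (intro sum_mono) auto
  moreover have "c * card (P - ?U) \<le> (if Ms = [] then 0 else fst (type_II_outputs u v Ms))"
    using "2.IH" "2.prems" by auto
  ultimately show ?case
    unfolding fst_type_I_outputs_Cons by linarith
next
  case (4 A B P Q M Ms)
  \<comment> \<open>Every first-level subtask of a type-II structure has \<open>A k = P\<close>, so
    each entry of the minimum already satisfies the bound.\<close>
  have "c * card P \<le> Min (u ` M)"
    using "4.prems"(1,3) by (auto split: if_splits)
  moreover have "c * card P \<le> fst (type_I_outputs u v Ms)" if "Ms \<noteq> []"
    using that "4.prems" by (intro "4.IH") auto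
  ultimately show ?case
    by (auto simp: split_beta)
qed auto

text \<open>First-level weights against label I are summed, so one strict summand makes the total
  strict; deeper levels need only the weak bound.\<close>

lemma fst_type_I_outputs_gt:
  fixes c :: real
  assumes "type_I_structure A B P Q Ms" "finite P"
    and ge: "\<And>j. j \<in> \<Union> (set Ms) \<Longrightarrow> c * card (A j) \<le> u j"
    and "i \<in> hd Ms" "c * card (A i) < u i"
  shows "c * card P < fst (type_I_outputs u v Ms)"
proof (cases Ms)
  case Nil
  then show ?thesis
    using assms(1) by simp
next
  case (Cons M Ms')
  let ?U = "\<Union>k\<in>M. A k"
  have str: "type_I_structure A B P Q (M # Ms')"
    using assms(1) Cons by simp
  have "c * card P = (\<Sum>k\<in>M. c * card (A k)) + c * card (P - ?U)"
    using card_type_I_structure_Cons[OF str \<open>finite P\<close>] by (simp add: sum_distrib_left distrib_left)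
  moreover have "(\<Sum>k\<in>M. c * card (A k)) < sum u M"
    using str assms(4,5) ge Cons by (intro sum_strict_mono_ex1) auto
  moreover have "c * card (P - ?U) \<le> (if Ms' = [] then 0 else fst (type_II_outputs u v Ms'))"
    using fst_outputs_ge(2)[of A B "P - ?U" Q Ms' c u v] str \<open>finite P\<close> ge Cons by auto
  ultimately show ?thesis
    unfolding Cons fst_type_I_outputs_Cons by linarith
qed

lemma snd_type_I_outputs_le:
  assumes "type_I_structure A B P Q Ms" "i \<in> hd Ms"
  shows "snd (type_I_outputs u v Ms) \<le> v i"
  using assms by (cases Ms) (auto simp: split_beta min_le_iff_disj)

text \<open>Bounds the training fractions for label I by 1, as the convexity estimate
  requires.\<close>

lemma subset_of_structure:
  shows "type_I_structure A B P Q Ms \<Longrightarrow> j \<in> \<Union> (set Ms) \<Longrightarrow> A j \<subseteq> P"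
    and "type_II_structure A B P Q Ms \<Longrightarrow> j \<in> \<Union> (set Ms) \<Longrightarrow> A j \<subseteq> P"
  by (induction A B P Q Ms and A B P Q Ms rule: type_I_structure_type_II_structure.induct)
     (fastforce split: if_splits)+

lemma sigmoid_less_1: "sigmoid z < 1"
  by (simp add: sigmoid_def add_pos_pos)

theorem theorem1:
  fixes D\<^sub>I :: "'a set" and D\<^sub>I\<^sub>I :: "'b set"
    and A :: "nat \<Rightarrow> 'a set" and B :: "nat \<Rightarrow> 'b set"
    and K L i :: nat and Ms :: "nat set list"
    and G :: "nat \<Rightarrow> real ^ 'n \<Rightarrow> real"
    and s bs x :: "nat \<Rightarrow> real" and b w\<^sub>I w\<^sub>I\<^sub>I :: real
    and t :: "real ^ 'n"
  assumes "finite D\<^sub>I" and "D\<^sub>I \<noteq> {}" and "finite D\<^sub>I\<^sub>I" and "D\<^sub>I\<^sub>I \<noteq> {}"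
    and "L \<ge> 1" and "length Ms = L"
    and "type_I_structure A B D\<^sub>I D\<^sub>I\<^sub>I Ms"
    and "\<Union> (set Ms) = {1..K}"
    and "\<And>j. j \<in> {1..K} \<Longrightarrow> 1-lipschitz_on UNIV (G j)"
    and "\<And>j. j \<in> {1..K} \<Longrightarrow> s j > 0"
    and "\<And>j. j \<in> {1..K} \<Longrightarrow> bs j = b"
    and "0 < b" and "b \<le> 1"
    and "\<And>j. j \<in> {1..K} \<Longrightarrow> x j = sigmoid (s j * G j t)"
    and "i \<in> hd Ms" and "x i > 0.5"
    and "\<And>j. j \<in> {1..K} \<Longrightarrow> j \<noteq> i \<Longrightarrow> x j \<ge> 1 - x i"
    and "(w\<^sub>I, w\<^sub>I\<^sub>I) = type_I_outputs (weight_I D\<^sub>I A bs x) (weight_II D\<^sub>I\<^sub>I B bs x) Ms"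
  shows "w\<^sub>I > w\<^sub>I\<^sub>I"
proof -
  define w where "w = ln (1 - belief_II b 1 (x i))"
  define u where "u = weight_I D\<^sub>I A bs x"
  define v where "v = weight_II D\<^sub>I\<^sub>I B bs x"
  have hd: "hd Ms \<in> set Ms"
    using assms(5,6) by (intro hd_in_set) auto
  have i: "i \<in> {1..K}"
    using hd assms(8,15) by blast
  have Ai: "A i \<subseteq> D\<^sub>I" "A i \<noteq> {}" "B i = D\<^sub>I\<^sub>I"
    using subset_of_structure(1)[OF assms(7)] i assms(7,8,15) by (cases Ms; auto)+
  have card: "0 < card D\<^sub>I" "0 < card D\<^sub>I\<^sub>I" "0 < card (A i)"
    using assms(1-4) Ai by (auto simp: card_gt_0_iff finite_subset)
  have xi: "1/2 < x i" "x i < 1"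
    using assms(14)[OF i] assms(16) by (auto simp: sigmoid_less_1)
  \<comment> \<open>On the open interval from 0 to 1 \<open>artanh\<close> is positive, so
    \<open>w\<close> is negative.\<close>
  have "0 < b * (x i - 1/2) / (1 - b / 2)" "b * (x i - 1/2) / (1 - b / 2) < 1"
    using belief_margin_less[of b "x i - 1/2"] xi assms(12,13) by auto
  then have w: "w < 0"
    using ln_belief_II_full[OF assms(12,13) xi] by (simp add: w_def artanh_def)
  \<comment> \<open>The weight \<open>w\<close> is spread evenly over the examples of label I, so
    \<open>A j\<close> receives its fraction of \<open>w\<close>.\<close>
  have u_ge: "w / card D\<^sub>I * card (A j) \<le> u j" if "j \<in> \<Union> (set Ms)" for j
  proof -
    let ?f = "real (card (A j)) / real (card D\<^sub>I)"
    have j: "j \<in> {1..K}"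
      using that assms(8) by simp
    have "card (A j) \<le> card D\<^sub>I"
      using subset_of_structure(1)[OF assms(7) that] assms(1) by (simp add: card_mono)
    then have f: "0 \<le> ?f" "?f \<le> 1"
      using card by auto
    \<comment> \<open>For \<open>j = i\<close> this follows from \<open>x i > 1/2\<close>.\<close>
    have "1 - x i \<le> x j"
      using assms(17)[OF j] xi by (cases "j = i") auto
    then have "?f * w \<le> u j"
      using ln_belief_I_ge[OF assms(12,13) f xi] assms(11)[OF j]
      by (simp add: w_def u_def weight_I_def)
    then show ?thesis
      by (simp add: mult.commute)
  qed
  \<comment> \<open>Subtask \<open>i\<close> gives strictness: its share of \<open>w\<close> is
    negative, while its weight against label I is 0.\<close>
  have "w / card D\<^sub>I * card (A i) < 0"
    using w card by (simp add: mult_neg_pos divide_neg_pos)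
  moreover have "u i = 0"
    using xi by (simp add: u_def weight_I_def belief_I_def)
  ultimately have "w / card D\<^sub>I * card D\<^sub>I < fst (type_I_outputs u v Ms)"
    using assms(15) by (intro fst_type_I_outputs_gt[OF assms(7,1) u_ge]) auto
  then have "w < w\<^sub>I"
    using card assms(18) unfolding u_def v_def by (metis fst_conv less_numeral_extra(3) nonzero_divide_eq_eq of_nat_0_less_iff)
  \<comment> \<open>Subtask \<open>i\<close> is in the first level, so \<open>B i\<close> is all of
    \<open>D\<^sub>I\<^sub>I\<close> and its fraction is 1.\<close>
  moreover have "v i = w"
    using card assms(11)[OF i] Ai by (simp add: v_def w_def weight_II_def)
  then have "w\<^sub>I\<^sub>I \<le> w"
    using snd_type_I_outputs_le[OF assms(7,15), of u v] assms(18) unfolding u_def v_def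
    by (metis snd_conv)
  ultimately show ?thesis
    by simp
qed

end
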